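(* Let $(X,+)$ be a noncommutative semigroup, $\vec k=(k_n)_{n\in\mathbb N}\subseteq\mathbb N$ an increasing sequence and, for every $l\in\mathbb N$, $(y_{l,n})_{n\in\mathbb N}$ a sequence in $X$. If $\mathcal U\subseteq X^{\mathbb N}$ is pointwise closed, then there exist: non-empty finite sets $E_n\subseteq\mathbb N$ with $\max E_n<\min E_{n+1}$ for all $n$; integers $m_n\in\mathbb N$ and finite sets $E^n_1<\dots<E^n_{m_n+1}$ with $E_n=E^n_1\cup\dots\cup E^n_{m_n+1}$; sets $H^n_i\subseteq E^n_i$ for $1\le i\le m_n$; and elements $\beta^n_1,\dots,\beta^n_{m_n+1}\in X$ with $\beta^n_i=\sum_{j\in E^n_i\setminus H^n_i}y_{l^n_j,j}$ ($1\le l^n_j\le k_j$) for $1\le i\le m_n$ and $\beta^n_{m_n+1}=\sum_{j\in E^n_{m_n+1}}y_{l^n_j,j}$ ($1\le l^n_j\le k_j$), for every $n\in\mathbb N$, such that for every function $f:\mathbb N\to\mathbb N$ with $f(n)\le k_n$ for every $n$, setting $x_n=\Big(\sum_{i=1}^{m_n}\big(\beta^n_i+\sum_{t\in H^n_i}y_{f(n),t}\big)\Big)+\beta^n_{m_n+1}$, either $[FS((x_n)_{n\in\mathbb N})]^\omega\subseteq\mathcal U$ or $[FS((x_n)_{n\in\mathbb N})]^\omega\subseteq X^{\mathbb N}\setminus\mathcal U$.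
   Context: $\mathbb N=\{1,2,\dots\}$. For finite $A,B\subseteq\mathbb N$, $A<B$ means $\max A<\min B$. Sums $\sum_{j\in F}z_j$ over finite $F\subseteq\mathbb N$ and $\sum_{i=1}^m$ are taken in increasing order of the index. $X^{\mathbb N}$ carries the product topology ($X$ discrete); pointwise closed means closed in it. For a sequence $(x_n)$ in $X$, $FS((x_n))=\{x_{n_1}+\dots+x_{n_\lambda}:\lambda\in\mathbb N,\ n_1<\dots<n_\lambda\}$; for $y=x_{n_1}+\dots+x_{n_\lambda}$, $z=x_{m_1}+\dots+x_{m_\nu}$ in $FS((x_n))$ write $y<z$ if $n_\lambda<m_1$; $[FS((x_n))]^\omega=\{(y_n)_{n\in\mathbb N}:y_n\in FS((x_n)),\ y_n<y_{n+1}\ \forall n\}$. *)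

theory Defs
  imports "HOL-Analysis.Analysis"
begin

(* The positive integers are the set {1..} :: nat set. A sequence indexed by them is a
   function on nat of which only the values on {1..} matter; where sequences are themselves
   the points of a space, they are taken extensional, i.e. in {1..} \<rightarrow>\<^sub>E UNIV. *)

(* A semigroup has no neutral element, so the empty sum is deliberately left unspecified. *)
fun sg_sum_list :: "'a::semigroup_add list \<Rightarrow> 'a" where
  "sg_sum_list [] = undefined"
| "sg_sum_list [a] = a"
| "sg_sum_list (a # b # as) = a + sg_sum_list (b # as)"

(* Sum of z j over j in F in increasing order of j; meaningful for finite nonempty F. *)
definition ord_sum :: "(nat \<Rightarrow> 'a::semigroup_add) \<Rightarrow> nat set \<Rightarrow> 'a" where
  "ord_sum z F = sg_sum_list (map z (sorted_list_of_set F))"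

lemma ord_sum_singleton [simp]: "ord_sum z {a} = z a"
  by (simp add: ord_sum_def)

lemma ord_sum_insert_less:
  assumes "finite F" "F \<noteq> {}" "\<And>j. j \<in> F \<Longrightarrow> a < j"
  shows "ord_sum z (insert a F) = z a + ord_sum z F"
proof -
  have "sorted_list_of_set (insert a F) = a # sorted_list_of_set F"
    using assms
    by (subst sorted_list_of_set.fold_insort_key.insert)
      (auto intro!: insort_is_Cons simp: less_imp_le)
  moreover obtain b bs where "sorted_list_of_set F = b # bs"
    using assms(1,2) by (metis list.exhaust sorted_list_of_set.sorted_key_list_of_set_eq_Nil_iff)
  ultimately show ?thesis
    by (simp add: ord_sum_def)
qed

definition index_set :: "nat set \<Rightarrow> bool" where
  "index_set F \<longleftrightarrow> finite F \<and> F \<noteq> {} \<and> F \<subseteq> {1..}"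

definition block_less :: "nat set \<Rightarrow> nat set \<Rightarrow> bool" where
  "block_less A B \<longleftrightarrow> Max A < Min B"

definition FS :: "(nat \<Rightarrow> 'a::semigroup_add) \<Rightarrow> 'a set" where
  "FS x = {ord_sum x F |F. index_set F}"

(* The relation y < z on FS x refers to the representations of y and z as sums of terms
   of x. An element may have several, so a sequence y_1 < y_2 < ... in FS x comes with one
   representing index set F n for each term, used for both neighbouring comparisons. *)
definition FS_omega :: "(nat \<Rightarrow> 'a::semigroup_add) \<Rightarrow> (nat \<Rightarrow> 'a) set" where
  "FS_omega x = {y \<in> {1..} \<rightarrow>\<^sub>E FS x.
     \<exists>F. \<forall>n\<ge>1. index_set (F n) \<and> y n = ord_sum x (F n) \<and> block_less (F n) (F (Suc n))}"

definition pointwise_closed :: "(nat \<Rightarrow> 'a) set \<Rightarrow> bool" where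
  "pointwise_closed U \<longleftrightarrow> closedin (product_topology (\<lambda>_. discrete_topology UNIV) {1..}) U"

end

theory Submission imports Defs begin

text \<open>The \<open>x\<^sub>n\<close> are values of words \<open>w\<^sub>n\<close> whose letters sit at positions in \<open>E\<^sub>n\<close> and whose
  variable, at the positions in the \<open>H\<^sup>n\<^sub>i\<close>, is replaced by \<open>f(n)\<close>. There is an idempotent ultrafilter
  \<open>q\<close> on \<open>X\<close> each of whose members contains all values of some such variable word, located
  arbitrarily far out. The complement of \<open>\<U>\<close> being open, there is a tree, branching
  into \<open>q\<close>-large sets, whose branches all lie in \<open>\<U>\<close> or all lie outside. Since \<open>q\<close> is idempotent, the
  words can be chosen one after the other, as in the proof of Hindman's theorem, in such a way that
  every sequence in \<open>[FS(x\<^sub>n)]\<^sup>\<omega>\<close> is a branch of this tree, simultaneously for all \<open>f\<close>.\<close>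

section \<open>Idempotents in compact right topological semigroups\<close>

text \<open>Zorn's lemma combined with compactness: a chain of non-empty closed sets has non-empty
  intersection, and \<open>Inter\<close> puts it back into the family. It yields minimal closed
  subsemigroups and minimal closed left ideals.\<close>

lemma minimal_closed_set:
  assumes X: "compact_space X" and "\<F> \<noteq> {}"
    and closed: "\<And>S. S \<in> \<F> \<Longrightarrow> closedin X S \<and> S \<noteq> {}"
    and Inter: "\<And>\<C>. \<C> \<noteq> {} \<Longrightarrow> \<C> \<subseteq> \<F> \<Longrightarrow> \<Inter>\<C> \<noteq> {} \<Longrightarrow> \<Inter>\<C> \<in> \<F>"
  obtains M where "M \<in> \<F>" "\<And>S. S \<in> \<F> \<Longrightarrow> S \<subseteq> M \<Longrightarrow> S = M"
proof -
  \<comment> \<open>Complements turn minimal into maximal and intersections into unions, the form in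
    which Zorn's lemma is applied.\<close>
  have "\<Union>\<C> \<in> uminus ` \<F>" if ne: "\<C> \<noteq> {}" and ch: "subset.chain (uminus ` \<F>) \<C>" for \<C>
  proof -
    let ?D = "uminus ` \<C>"
    have sub: "?D \<subseteq> \<F>" using ch by (auto simp: subset_chain_def)
    have tot: "S \<subseteq> T \<or> T \<subseteq> S" if "S \<in> ?D" "T \<in> ?D" for S T
    proof -
      have "- S \<in> \<C>" "- T \<in> \<C>" using that by auto
      then have "- S \<subseteq> - T \<or> - T \<subseteq> - S"
        using ch unfolding subset_chain_def by blast
      then show ?thesis by blast
    qed
    \<comment> \<open>A finite subfamily of a chain has a least member, which gives the finite
      intersection property.\<close>
    have min: "\<exists>S\<in>\<G>. \<forall>T\<in>\<G>. S \<subseteq> T" if "finite \<G>" "\<G> \<noteq> {}" "\<G> \<subseteq> ?D" for \<G>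
      using that
    proof (induction rule: finite_ne_induct)
      case (insert T \<G>)
      then obtain S where "S \<in> \<G>" "\<forall>T\<in>\<G>. S \<subseteq> T" by auto
      moreover have "S \<subseteq> T \<or> T \<subseteq> S" using insert.prems \<open>S \<in> \<G>\<close> by (intro tot) auto
      ultimately show ?case by (metis insert_iff order_trans order_refl)
    qed auto
    have "\<Inter>?D \<noteq> {}"
    proof (rule compact_space_fip[THEN iffD1, rule_format, OF X], intro conjI ballI allI impI)
      show "closedin X C" if "C \<in> ?D" for C using closed subsetD[OF sub that] by blast
      show "\<Inter>\<G> \<noteq> {}" if "finite \<G> \<and> \<G> \<subseteq> ?D" for \<G>
      proof (cases "\<G> = {}")
        case False
        have fin: "finite \<G>" and GD: "\<G> \<subseteq> ?D" using that by (simp_all only:)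
        from min[OF fin False GD] obtain S where S: "S \<in> \<G>" "\<forall>T\<in>\<G>. S \<subseteq> T" ..
        have "S \<noteq> {}" using closed[OF subsetD[OF sub subsetD[OF GD S(1)]]] by (rule conjunct2)
        then show ?thesis using S(2) by blast
      qed auto
    qed
    then have "\<Inter>?D \<in> \<F>" using Inter[OF _ sub] ne by blast
    moreover have "\<Union>\<C> = - \<Inter>?D" by auto
    ultimately show ?thesis by blast
  qed
  from subset_Zorn_nonempty[OF _ this] \<open>\<F> \<noteq> {}\<close>
  obtain N where N: "N \<in> uminus ` \<F>" "\<forall>S\<in>uminus ` \<F>. N \<subseteq> S \<longrightarrow> S = N" by auto
  show thesis
  proof (rule that[of "- N"])
    show "- N \<in> \<F>" using N(1) by auto
    show "S = - N" if "S \<in> \<F>" "S \<subseteq> - N" for S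
      using that N(2) by (metis Compl_subset_Compl_iff double_compl image_eqI)
  qed
qed

text \<open>Take a minimal closed subsemigroup \<open>A\<close> and any \<open>e\<close> in it. The
  set of all \<open>f p e\<close> with \<open>p\<close> in \<open>A\<close> is again a closed
  subsemigroup, hence all of \<open>A\<close>, so some \<open>p\<close> in \<open>A\<close>
  satisfies \<open>f p e = e\<close>. These \<open>p\<close> form a closed subsemigroup too, hence
  all of \<open>A\<close>, and \<open>e\<close> is among them.\<close>

lemma ellis_numakura:
  fixes f :: "'a \<Rightarrow> 'a \<Rightarrow> 'a"
  assumes X: "compact_space X" "Hausdorff_space X"
    and S: "closedin X S" "S \<noteq> {}" "\<And>p q. p \<in> S \<Longrightarrow> q \<in> S \<Longrightarrow> f p q \<in> S"
    and assoc: "\<And>p q r. f (f p q) r = f p (f q r)"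
    and cont: "\<And>q. q \<in> topspace X \<Longrightarrow> continuous_map X X (\<lambda>p. f p q)"
  obtains e where "e \<in> S" "f e e = e"
proof -
  define \<F> where "\<F> = {A. closedin X A \<and> A \<noteq> {} \<and> A \<subseteq> S \<and> (\<forall>p\<in>A. \<forall>q\<in>A. f p q \<in> A)}"
  obtain A where A: "A \<in> \<F>" and min: "\<And>B. B \<in> \<F> \<Longrightarrow> B \<subseteq> A \<Longrightarrow> B = A"
  proof (rule minimal_closed_set[OF X(1), of \<F>])
    show "\<F> \<noteq> {}" using S by (auto simp: \<F>_def)
    fix \<C> assume "\<C> \<noteq> {}" "\<C> \<subseteq> \<F>" "\<Inter>\<C> \<noteq> {}"
    then show "\<Inter>\<C> \<in> \<F>"
      unfolding \<F>_def by (auto intro!: closedin_Inter) blast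
  qed (auto simp: \<F>_def)
  obtain e where e: "e \<in> A" using A by (auto simp: \<F>_def)
  have clA: "closedin X A" using A by (simp add: \<F>_def)
  have eX: "e \<in> topspace X" using e clA closedin_subset by blast
  have sub: "\<And>p q. p \<in> A \<Longrightarrow> q \<in> A \<Longrightarrow> f p q \<in> A" using A by (simp add: \<F>_def)
  have "closedin X ((\<lambda>p. f p e) ` A)"
    using compactin_imp_closedin[OF X(2)] image_compactin[OF _ cont[OF eX]]
      closedin_compact_space[OF X(1) clA] by blast
  \<comment> \<open>By associativity (pe)(qe) = (p(eq))e.\<close>
  moreover have "f (f p e) (f q e) \<in> (\<lambda>p. f p e) ` A" if "p \<in> A" "q \<in> A" for p q
    using that e by (auto simp: sub assoc intro!: image_eqI[of _ _ "f p (f e q)"])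
  ultimately have "(\<lambda>p. f p e) ` A = A"
    using A e sub by (intro min) (auto simp: \<F>_def image_subset_iff subset_iff)
  then have ne: "{p \<in> A. f p e = e} \<noteq> {}" using e by force
  have "closedin X {p \<in> topspace X. f p e \<in> {e}}"
    using closedin_continuous_map_preimage[OF cont[OF eX]] closedin_Hausdorff_singleton[OF X(2) eX]
    by blast
  then have "closedin X ({p \<in> topspace X. f p e \<in> {e}} \<inter> A)" using clA by blast
  moreover have "{p \<in> topspace X. f p e \<in> {e}} \<inter> A = {p \<in> A. f p e = e}"
    using closedin_subset[OF clA] by auto
  ultimately have "{p \<in> A. f p e = e} = A"
    using ne A by (intro min) (auto simp: \<F>_def assoc)
  then have "e \<in> S" "f e e = e" using e A by (auto simp: \<F>_def)
  then show thesis by (rule that)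
qed

section \<open>Ultrafilters on semigroups\<close>

text \<open>As predicates on sets, ultrafilters are points of a product of two-point spaces, so
  compactness comes from Tychonoff's theorem. Upward closure follows from the three clauses.\<close>

definition ultra :: "('a set \<Rightarrow> bool) \<Rightarrow> bool" where
  "ultra p \<longleftrightarrow> p UNIV \<and> (\<forall>A. p (- A) \<longleftrightarrow> \<not> p A) \<and> (\<forall>A B. p A \<longrightarrow> p B \<longrightarrow> p (A \<inter> B))"

lemma ultra_mono:
  assumes "ultra p" "p A" "A \<subseteq> B"
  shows "p B"
proof (rule ccontr)
  assume "\<not> p B"
  then have "p (A \<inter> - B)" using assms(1,2) by (simp add: ultra_def)
  moreover have "A \<inter> - B = - UNIV" using assms(3) by auto
  moreover have "\<not> p (- UNIV)" using assms(1) unfolding ultra_def by blast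
  ultimately show False by simp
qed

lemma ultra_Int: "ultra p \<Longrightarrow> p A \<Longrightarrow> p B \<Longrightarrow> p (A \<inter> B)"
  by (simp add: ultra_def)

lemma ultra_Compl: "ultra p \<Longrightarrow> p (- A) \<longleftrightarrow> \<not> p A"
  by (simp add: ultra_def)

lemma ultra_INT:
  assumes "ultra p" "finite I" "\<And>i. i \<in> I \<Longrightarrow> p (A i)"
  shows "p (\<Inter>i\<in>I. A i)"
  using assms(2,3) by (induction) (use assms(1) in \<open>auto simp: ultra_def\<close>)

lemma ultra_nonempty: "ultra p \<Longrightarrow> p A \<Longrightarrow> A \<noteq> {}"
  unfolding ultra_def by (metis Compl_UNIV_eq)

lemma ultra_vimage: "ultra p \<Longrightarrow> ultra (\<lambda>A. p (g -` A))"
  unfolding ultra_def by (simp add: vimage_Compl)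

lemma ultra_cong:
  assumes "ultra p" "p E" "\<And>x. x \<in> E \<Longrightarrow> x \<in> A \<longleftrightarrow> x \<in> B"
  shows "p A \<longleftrightarrow> p B"
proof -
  have "p A \<longleftrightarrow> p (A \<inter> E)" for A
    using assms(1,2) ultra_Int ultra_mono by (metis inf_le1)
  moreover have "A \<inter> E = B \<inter> E" using assms(3) by auto
  ultimately show ?thesis by metis
qed

text \<open>For a decreasing sequence \<open>D\<close> these are the ultrafilters living on its
  tails. Below, \<open>D n\<close> consists of words located beyond \<open>n\<close>.\<close>

definition at_end :: "(nat \<Rightarrow> 'a set) \<Rightarrow> ('a set \<Rightarrow> bool) set" where
  "at_end D = {p. ultra p \<and> (\<forall>n. p (D n))}"

section \<open>The compact Hausdorff space containing the ultrafilters\<close>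

abbreviation utop :: "('a set \<Rightarrow> bool) topology" where
  "utop \<equiv> product_topology (\<lambda>_. discrete_topology UNIV) UNIV"

lemma compact_utop: "compact_space utop"
  by (simp add: compact_space_product_topology compact_space_discrete_topology)

lemma Hausdorff_utop: "Hausdorff_space utop"
  by (simp add: Hausdorff_space_product_topology)

lemma continuous_utop_eval: "continuous_map utop (discrete_topology UNIV) (\<lambda>p. p A)"
  by (rule continuous_map_product_projection) simp

lemma closedin_utop_eval: "closedin utop {p. p A}"
  using closedin_continuous_map_preimage[OF continuous_utop_eval, of "{True}" A] by simp

lemma closedin_utop_not_eval: "closedin utop {p. \<not> p A}"
  using closedin_continuous_map_preimage[OF continuous_utop_eval, of "{False}" A] by simp

text \<open>Each axiom instance and each condition \<open>p (D n)\<close> involves only finitely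
  many coordinates of \<open>p\<close>, so it defines a closed set.\<close>

lemma closedin_at_end: "closedin utop (at_end D)"
proof -
  let ?R = "{p. p UNIV} \<inter> (\<Inter>A. ({p. p (- A)} \<union> {p. p A}) \<inter> ({p. \<not> p (- A)} \<union> {p. \<not> p A}))
     \<inter> (\<Inter>A. \<Inter>B. {p. \<not> p A} \<union> {p. \<not> p B} \<union> {p. p (A \<inter> B)}) \<inter> (\<Inter>n. {p. p (D n)})"
  have "closedin utop ?R"
    by (intro closedin_Int closedin_INT closedin_Un closedin_utop_eval closedin_utop_not_eval) auto
  moreover have "?R = at_end D" 
    unfolding at_end_def ultra_def by auto
  ultimately show ?thesis by metis
qed

text \<open>Principal ultrafilters at points of \<open>D n\<close> show that the nested closed
  conditions are each satisfiable; compactness gives a common solution.\<close>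

lemma at_end_nonempty:
  assumes "\<And>n. D n \<noteq> {}" "decseq D"
  shows "at_end D \<noteq> {}"
proof -
  have "(\<Inter>n. at_end (\<lambda>_. D n)) \<noteq> {}"
  proof (rule compact_space_imp_nest[OF compact_utop closedin_at_end])
    fix n
    obtain x where "x \<in> D n" using assms(1) by blast
    then have "(\<lambda>A. x \<in> A) \<in> at_end (\<lambda>_. D n)" by (auto simp: at_end_def ultra_def)
    then show "at_end (\<lambda>_. D n) \<noteq> {}" by blast
  next
    show "decseq (\<lambda>n. at_end (\<lambda>_. D n))"
      using assms(2) unfolding decseq_def at_end_def by (blast intro: ultra_mono)
  qed
  then show ?thesis by (auto simp: at_end_def)
qed

section \<open>Multiplication of ultrafilters\<close>

definition ultra_mult ::
  "('a \<Rightarrow> 'a \<Rightarrow> 'a) \<Rightarrow> ('a set \<Rightarrow> bool) \<Rightarrow> ('a set \<Rightarrow> bool) \<Rightarrow> 'a set \<Rightarrow> bool" where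
  "ultra_mult f p q A \<longleftrightarrow> p {x. q {y. f x y \<in> A}}"

context semigroup
begin

abbreviation "umult \<equiv> ultra_mult f"

lemma umult_assoc: "umult (umult p q) r = umult p (umult q r)"
  by (simp add: ultra_mult_def fun_eq_iff assoc)

text \<open>For fixed \<open>q\<close>, the coordinate of the product at a set is a coordinate of
  \<open>p\<close> at another set. Continuity in the left factor is what makes the images of closed
  sets under right multiplication closed.\<close>

lemma continuous_umult: "continuous_map utop utop (\<lambda>p. umult p q)"
  unfolding continuous_map_componentwise_UNIV ultra_mult_def by (intro allI continuous_utop_eval)

lemma ultra_umult:
  assumes "ultra p" "ultra q"
  shows "ultra (umult p q)"
proof -
  have "{x. q {y. x \<^bold>* y \<notin> A}} = - {x. q {y. x \<^bold>* y \<in> A}}" for A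
    using ultra_Compl[OF assms(2)] by (auto simp: Collect_neg_eq)
  moreover have "p {x. q {y. x \<^bold>* y \<in> A \<inter> B}}"
    if "p {x. q {y. x \<^bold>* y \<in> A}}" "p {x. q {y. x \<^bold>* y \<in> B}}" for A B
    by (rule ultra_mono[OF assms(1) ultra_Int[OF assms(1) that]])
      (auto simp: Collect_conj_eq intro: ultra_Int[OF assms(2)])
  ultimately show ?thesis
    using assms unfolding ultra_def ultra_mult_def by simp
qed

text \<open>The tail required of the second factor may depend on the first factor \<open>x\<close>,
  since \<open>q\<close> contains every \<open>D' m\<close>. This lets concatenation of located
  words act although it respects positions only when the right word lies far enough out.\<close>

lemma umult_at_end:
  assumes "p \<in> at_end D" "q \<in> at_end D'"
    and "\<And>n x. x \<in> D n \<Longrightarrow> \<exists>m. \<forall>y\<in>D' m. x \<^bold>* y \<in> D'' n"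
  shows "umult p q \<in> at_end D''"
proof -
  have "ultra p" "ultra q" "\<And>n. p (D n)" "\<And>n. q (D' n)" using assms(1,2) by (auto simp: at_end_def)
  moreover have "p {x. q {y. x \<^bold>* y \<in> D'' n}}" for n
  proof (rule ultra_mono[OF \<open>ultra p\<close> \<open>p (D n)\<close>])
    show "D n \<subseteq> {x. q {y. x \<^bold>* y \<in> D'' n}}"
    proof
      fix x assume "x \<in> D n"
      then obtain m where "\<forall>y\<in>D' m. x \<^bold>* y \<in> D'' n" using assms(3) by blast
      then have "D' m \<subseteq> {y. x \<^bold>* y \<in> D'' n}" by blast
      then show "x \<in> {x. q {y. x \<^bold>* y \<in> D'' n}}"
        using ultra_mono[OF \<open>ultra q\<close> \<open>q (D' m)\<close>] by simp
    qed
  qed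
  ultimately show ?thesis by (simp add: at_end_def ultra_umult ultra_mult_def[symmetric])
qed

lemma umult_vimage:
  assumes "\<And>x y. h (x \<^bold>* y) = h x \<^bold>* h y"
  shows "(\<lambda>A. umult p q (h -` A)) = umult (\<lambda>A. p (h -` A)) (\<lambda>A. q (h -` A))"
  by (simp add: ultra_mult_def fun_eq_iff assms vimage_def)

text \<open>The ultrafilter \<open>q\<close> is an idempotent in a minimal closed left ideal of the ultrafilters of
  constant elements. An idempotent \<open>p\<close> of variable elements with \<open>p q = q p = p\<close> is mapped by each
  substitution to an idempotent \<open>r\<close> with \<open>r q = q r = r\<close>, and minimality forces \<open>r = q\<close>.\<close>

lemma line_ultrafilter:
  fixes C V :: "nat \<Rightarrow> 'a set" and T :: "'l \<Rightarrow> 'a \<Rightarrow> 'a"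
  assumes C: "\<And>n. C n \<noteq> {}" "decseq C" and V: "\<And>n. V n \<noteq> {}" "decseq V"
    and CC: "\<And>n x. x \<in> C n \<Longrightarrow> \<exists>m. \<forall>y\<in>C m. x \<^bold>* y \<in> C n"
    and CV: "\<And>n x. x \<in> C n \<Longrightarrow> \<exists>m. \<forall>y\<in>V m. x \<^bold>* y \<in> V n"
    and VC: "\<And>n x. x \<in> V n \<Longrightarrow> \<exists>m. \<forall>y\<in>C m. x \<^bold>* y \<in> V n"
    and VV: "\<And>n x. x \<in> V n \<Longrightarrow> \<exists>m. \<forall>y\<in>V m. x \<^bold>* y \<in> V n"
    and hom: "\<And>a x y. T a (x \<^bold>* y) = T a x \<^bold>* T a y"
    and id: "\<And>a x. x \<in> C 0 \<Longrightarrow> T a x = x"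
    and TV: "\<And>a n. a \<in> J \<Longrightarrow> \<exists>m. T a ` V m \<subseteq> C n"
  obtains q where "q \<in> at_end C" "umult q q = q"
    "\<And>A n J'. q A \<Longrightarrow> finite J' \<Longrightarrow> J' \<subseteq> J \<Longrightarrow> \<exists>w\<in>V n. \<forall>a\<in>J'. T a w \<in> A"
proof -
  let ?C = "at_end C" and ?V = "at_end V"
  have ends: "\<And>p q. p \<in> ?C \<Longrightarrow> q \<in> ?C \<Longrightarrow> umult p q \<in> ?C"
    "\<And>p q. p \<in> ?C \<Longrightarrow> q \<in> ?V \<Longrightarrow> umult p q \<in> ?V"
    "\<And>p q. p \<in> ?V \<Longrightarrow> q \<in> ?C \<Longrightarrow> umult p q \<in> ?V"
    "\<And>p q. p \<in> ?V \<Longrightarrow> q \<in> ?V \<Longrightarrow> umult p q \<in> ?V"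
    by (erule (1) umult_at_end, erule CC CV VC VV)+
  have img: "closedin utop ((\<lambda>p. umult p q) ` A)" if "closedin utop A" for q A
    using compactin_imp_closedin[OF Hausdorff_utop] image_compactin[OF _ continuous_umult]
      closedin_compact_space[OF compact_utop that] by blast
  \<comment> \<open>The closed left ideals of \<open>?C\<close>; a minimal one \<open>L\<close> is
    in particular a compact semigroup and so contains an idempotent \<open>q\<close>.\<close>
  define \<F> where "\<F> = {L. closedin utop L \<and> L \<noteq> {} \<and> L \<subseteq> ?C \<and> (\<forall>p\<in>?C. \<forall>q\<in>L. umult p q \<in> L)}"
  obtain L where L: "L \<in> \<F>" and min: "\<And>B. B \<in> \<F> \<Longrightarrow> B \<subseteq> L \<Longrightarrow> B = L"
  proof (rule minimal_closed_set[OF compact_utop, of \<F>])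
    show "\<F> \<noteq> {}"
      using closedin_at_end at_end_nonempty[OF C] ends by (auto simp: \<F>_def intro!: exI[of _ ?C])
    fix \<C> assume "\<C> \<noteq> {}" "\<C> \<subseteq> \<F>" "\<Inter>\<C> \<noteq> {}"
    then show "\<Inter>\<C> \<in> \<F>" unfolding \<F>_def by (auto intro!: closedin_Inter) blast
  qed (auto simp: \<F>_def)
  have Lid: "\<And>p q. p \<in> ?C \<Longrightarrow> q \<in> L \<Longrightarrow> umult p q \<in> L" and LC: "L \<subseteq> ?C"
    using L by (auto simp: \<F>_def)
  obtain q where q: "q \<in> L" "umult q q = q"
    by (rule ellis_numakura[OF compact_utop Hausdorff_utop, of L umult])
      (use L in \<open>auto simp: \<F>_def umult_assoc intro: continuous_umult\<close>)
  have qC: "q \<in> ?C" using q LC by blast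
  \<comment> \<open>The left ideal generated by \<open>r\<close> is closed and contained in
    \<open>L\<close>, so by minimality it equals \<open>L\<close> and contains
    \<open>q\<close>.\<close>
  have minq: "q \<in> (\<lambda>p. umult p r) ` ?C" if r: "r \<in> L" for r
  proof -
    have "(\<lambda>p. umult p r) ` ?C \<in> \<F>"
      using img[OF closedin_at_end] at_end_nonempty[OF C] ends LC Lid r
      by (auto simp: \<F>_def umult_assoc[symmetric])
    then have "(\<lambda>p. umult p r) ` ?C = L" by (rule min) (use r Lid in auto)
    then show ?thesis using q by simp
  qed
  \<comment> \<open>An idempotent sought among the products v q absorbs \<open>q\<close> on the
    right. Multiplying it by \<open>q\<close> on the left then gives \<open>p\<close>, which absorbs
    \<open>q\<close> on both sides and stays idempotent.\<close>
  obtain p' where p': "p' \<in> (\<lambda>v. umult v q) ` ?V" "umult p' p' = p'"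
  proof (rule ellis_numakura[OF compact_utop Hausdorff_utop, of "(\<lambda>v. umult v q) ` ?V" umult])
    fix r s assume "r \<in> (\<lambda>v. umult v q) ` ?V" "s \<in> (\<lambda>v. umult v q) ` ?V"
    then obtain v v' where "v \<in> ?V" "v' \<in> ?V" "r = umult v q" "s = umult v' q" by blast
    moreover have "umult v (umult q v') \<in> ?V" using ends calculation qC by blast
    ultimately show "umult r s \<in> (\<lambda>v. umult v q) ` ?V"
      by (auto simp: umult_assoc intro!: image_eqI[of _ _ "umult v (umult q v')"])
  qed (use img[OF closedin_at_end] at_end_nonempty[OF V] in \<open>auto simp: umult_assoc intro: continuous_umult\<close>)
  then obtain v where v: "v \<in> ?V" "p' = umult v q" by blast
  define p where "p = umult q p'"
  have p'q: "umult p' q = p'" by (simp add: v umult_assoc q)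
  have pV: "p \<in> ?V" using v qC ends by (simp add: p_def)
  have pp: "umult p p = p" by (simp add: p_def umult_assoc) (metis p'(2) p'q umult_assoc)
  have qp: "umult q p = p" and pq: "umult p q = p"
    using q p'q by (simp_all add: p_def umult_assoc) (simp_all add: umult_assoc[symmetric])
  have Tp: "(\<lambda>A. p (T a -` A)) = q" if a: "a \<in> J" for a
  proof -
    define r where "r = (\<lambda>A. p (T a -` A))"
    have "ultra p" "\<And>n. p (V n)" using pV by (auto simp: at_end_def)
    have "p (T a -` C n)" for n
      using TV[OF a, of n] ultra_mono[OF \<open>ultra p\<close> \<open>\<And>n. p (V n)\<close>] by (metis image_subset_iff_subset_vimage)
    then have rC: "r \<in> ?C" using ultra_vimage[OF \<open>ultra p\<close>] by (simp add: at_end_def r_def)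
    \<comment> \<open>The substitution fixes \<open>C 0\<close> pointwise and \<open>q\<close>
      contains \<open>C 0\<close>, so the image of \<open>q\<close> is \<open>q\<close>.\<close>
    have "q (T a -` A) = q A" for A
      using qC id by (intro ultra_cong[of q "C 0"]) (auto simp: at_end_def)
    then have Tq: "(\<lambda>A. q (T a -` A)) = q" by simp
    have rq: "umult r q = r" and qr: "umult q r = r" and rr: "umult r r = r"
      unfolding r_def using umult_vimage[of "T a", OF hom] Tq pp qp pq by metis+
    \<comment> \<open>Since r = rq lies in \<open>L\<close>, minimality gives q = sr. Then qr = srr
      = sr = q, whereas qr = r.\<close>
    have "r \<in> L" using Lid[OF rC q(1)] rq by simp
    then obtain s where "q = umult s r" using minq by blast
    then have "umult q r = q" by (simp add: umult_assoc rr)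
    then show ?thesis using qr r_def by simp
  qed
  show thesis
  proof (rule that[OF qC q(2)])
    fix A n J' assume A: "q A" "finite J'" "J' \<subseteq> J"
    have u: "ultra p" "p (V n)" using pV by (auto simp: at_end_def)
    \<comment> \<open>Every substitution in \<open>J'\<close> maps \<open>p\<close> to
      \<open>q\<close>, so the finitely many preimages of \<open>A\<close> are all
      \<open>p\<close>-large.\<close>
    have "p (V n \<inter> (\<Inter>a\<in>J'. T a -` A))"
      using Tp A by (intro ultra_Int[OF u] ultra_INT[OF u(1)]) (auto dest: fun_cong[of _ _ A])
    from ultra_nonempty[OF u(1) this] show "\<exists>w\<in>V n. \<forall>a\<in>J'. T a w \<in> A" by auto
  qed
qed

end

section \<open>Homogeneous trees and fusion\<close>

text \<open>A Galvin-type dichotomy for open sets: call a finite sequence good if some tree of large sets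
  above it has all its branches in the open set. A sequence with large many good one-step
  extensions is good, so from a bad sequence one stays bad along large sets.\<close>

lemma ultra_tree_dichotomy:
  fixes W :: "(nat \<Rightarrow> 'a) set"
  assumes q: "ultra q"
    and W: "\<And>z. z \<in> W \<Longrightarrow> \<exists>n. \<forall>z'. (\<forall>i<n. z' i = z i) \<longrightarrow> z' \<in> W"
  obtains A :: "'a list \<Rightarrow> 'a set" where "\<And>s. q (A s)"
    and "(\<forall>z. (\<forall>n. z n \<in> A (map z [0..<n])) \<longrightarrow> z \<in> W) \<or>
         (\<forall>z. (\<forall>n. z n \<in> A (map z [0..<n])) \<longrightarrow> z \<notin> W)"
proof -
  have qU: "q UNIV" using q by (simp add: ultra_def)
  \<comment> \<open>\<open>wit s A\<close>: every branch through \<open>s\<close> that obeys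
    \<open>A\<close> from \<open>s\<close> onwards lies in \<open>W\<close>.\<close>
  define wit where "wit s A \<longleftrightarrow> (\<forall>z. map z [0..<length s] = s \<longrightarrow>
      (\<forall>n\<ge>length s. z n \<in> A (map z [0..<n])) \<longrightarrow> z \<in> W)" for s and A :: "'a list \<Rightarrow> 'a set"
  define good where "good s \<longleftrightarrow> (\<exists>A. (\<forall>t. q (A t)) \<and> wit s A)" for s
  have step: "good s" if s: "q {x. good (s @ [x])}" for s
  proof -
    have "\<exists>A. (\<forall>t. q (A t)) \<and> (good (s @ [x]) \<longrightarrow> wit (s @ [x]) A)" for x
      using qU by (cases "good (s @ [x])") (auto simp: good_def intro!: exI[of _ "\<lambda>_. UNIV"])
    then obtain B where B: "\<And>x t. q (B x t)" "\<And>x. good (s @ [x]) \<Longrightarrow> wit (s @ [x]) (B x)"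
      by metis
    \<comment> \<open>Glue the witnesses: first choose a good extension of \<open>s\<close>, then
      follow the tree belonging to the chosen entry, which is recovered as
      \<open>t ! length s\<close>.\<close>
    define A where "A t = (if length t = length s then {x. good (s @ [x])}
      else if length t > length s then B (t ! length s) t else UNIV)" for t
    have "q (A t)" for t using s qU B by (simp add: A_def)
    moreover have "wit s A"
      unfolding wit_def
    proof (intro allI impI)
      fix z assume z: "map z [0..<length s] = s" "\<forall>n\<ge>length s. z n \<in> A (map z [0..<n])"
      let ?x = "z (length s)"
      have "good (s @ [?x])" using z(2)[rule_format, of "length s"] by (simp add: A_def)
      then have "wit (s @ [?x]) (B ?x)" by (rule B)
      moreover have "map z [0..<length (s @ [?x])] = s @ [?x]" using z(1) by simp
      moreover have "\<forall>n\<ge>length (s @ [?x]). z n \<in> B ?x (map z [0..<n])"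
      proof (intro allI impI)
        fix n assume "length (s @ [?x]) \<le> n"
        then show "z n \<in> B ?x (map z [0..<n])"
          using z(2)[rule_format, of n] by (simp add: A_def Suc_le_eq)
      qed
      ultimately show "z \<in> W" unfolding wit_def by blast
    qed
    ultimately show ?thesis unfolding good_def by blast
  qed
  show thesis
  proof (cases "good []")
    case True
    then obtain A where A: "\<And>t. q (A t)" "wit [] A" unfolding good_def by blast
    show thesis
      by (rule that[of A]) (use A in \<open>auto simp: wit_def\<close>)
  next
    case False
    \<comment> \<open>Bad nodes must have bad successors. Good nodes are never reached from the bad
      root; there the whole space keeps \<open>A t\<close> large.\<close>
    define A where "A t = {x. good t \<or> \<not> good (t @ [x])}" for t
    have qA: "q (A t)" for t
    proof (cases "good t")
      case True
      then show ?thesis using qU by (simp add: A_def)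
    next
      case False
      then have "q (- {x. good (t @ [x])})" using step ultra_Compl[OF q] by blast
      then show ?thesis using False by (simp add: A_def Collect_neg_eq)
    qed
    have "z \<notin> W" if z: "\<forall>n. z n \<in> A (map z [0..<n])" for z
    proof
      assume "z \<in> W"
      then obtain n where n: "\<forall>z'. (\<forall>i<n. z' i = z i) \<longrightarrow> z' \<in> W" using W by blast
      have "\<not> good (map z [0..<m])" for m
        by (induction m) (use False z in \<open>auto simp: A_def\<close>)
      \<comment> \<open>Openness enters here: an initial segment of \<open>z\<close> already forces
        membership in \<open>W\<close>, so the unrestricted tree shows it to be good.\<close>
      moreover have "wit (map z [0..<n]) (\<lambda>_. UNIV)"
        unfolding wit_def using n by (auto simp: list_eq_iff_nth_eq)
      then have "good (map z [0..<n])"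
        unfolding good_def using qU by (intro exI[of _ "\<lambda>_. UNIV"]) simp
      ultimately show False by blast
    qed
    with qA show thesis using that by blast
  qed
qed

section \<open>Fusion of the words along a tree\<close>

lemma ord_sum_insert_greater:
  assumes "finite F" "F \<noteq> {}" "\<And>j. j \<in> F \<Longrightarrow> j < a"
  shows "ord_sum z (insert a F) = ord_sum z F + z a"
  using assms
proof (induction rule: finite_linorder_min_induct)
  case (insert b F)
  show ?case
  proof (cases "F = {}")
    case True
    then show ?thesis using insert.prems ord_sum_insert_less[of "{a}" b z] by (simp add: insert_commute)
  next
    case False
    have "ord_sum z (insert b (insert a F)) = z b + ord_sum z (insert a F)"
      using insert by (intro ord_sum_insert_less) auto
    also have "\<dots> = z b + ord_sum z F + z a" using insert False by (simp add: add.assoc)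
    also have "z b + ord_sum z F = ord_sum z (insert b F)"
      using insert False by (intro ord_sum_insert_less[symmetric]) auto
    finally show ?thesis by (simp add: insert_commute)
  qed
qed simp

lemma block_sequence_Max_less_Min:
  assumes F: "\<And>n. 1 \<le> n \<Longrightarrow> index_set (F n) \<and> block_less (F n) (F (Suc n))" and "1 \<le> i" "i < j"
  shows "Max (F i) < Min (F j)"
  using \<open>i < j\<close>
proof (induction j)
  case (Suc j)
  show ?case
  proof (cases "i = j")
    case True
    then show ?thesis using F[of i] \<open>1 \<le> i\<close> by (simp add: block_less_def)
  next
    case False
    then have "Max (F i) < Min (F j)" using Suc by simp
    also have "\<dots> \<le> Max (F j)" using F[of j] \<open>1 \<le> i\<close> Suc.prems by (simp add: index_set_def)
    also have "\<dots> < Min (F (Suc j))" using F[of j] \<open>1 \<le> i\<close> Suc.prems by (simp add: block_less_def)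
    finally show ?thesis .
  qed
qed simp

text \<open>Hindman's construction for all choices of letters at once: \<open>g a w\<close> is the
  value of \<open>w\<close> at the letter \<open>a\<close>, and finiteness of \<open>L n\<close>
  lets each stage meet the requirements of all letters simultaneously. Hence \<open>w\<close> is
  chosen before \<open>f\<close>. Stage 0 carries no letters because sequences start at index
  1.\<close>

lemma fusion:
  fixes q :: "'a::semigroup_add set \<Rightarrow> bool" and g :: "'l \<Rightarrow> 'w \<Rightarrow> 'a"
  assumes q: "ultra q" and idem: "\<And>A. q A \<Longrightarrow> q {x. q {y. x + y \<in> A}}"
    and A: "\<And>s. q (A s)"
    and L: "\<And>n. finite (L n)" "L 0 = {}"
    and line: "\<And>B n w. q B \<Longrightarrow> \<exists>w'. R n w w' \<and> (\<forall>a\<in>L (Suc n). g a w' \<in> B)"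
  shows "\<exists>w. (\<forall>n. R n (w n) (w (Suc n))) \<and>
    (\<forall>f z F. (\<forall>n\<ge>1. f n \<in> L n) \<longrightarrow>
      (\<forall>n\<ge>1. index_set (F n) \<and> z n = ord_sum (\<lambda>i. g (f i) (w i)) (F n) \<and>
         block_less (F n) (F (Suc n))) \<longrightarrow>
      (\<forall>n. z (Suc n) \<in> A (map (\<lambda>i. z (Suc i)) [0..<n])))"
proof -
  \<comment> \<open>In a state \<open>(w, C, M)\<close> at stage \<open>n\<close>, the finite set \<open>M\<close> collects all sums of terms with index
    below \<open>n\<close>, and \<open>C\<close> is a large set that must contain all sums of terms with index at least \<open>n\<close>.\<close>
  define P where "P n = (\<lambda>(w, C, M :: 'a set). q C \<and> finite M \<and>
    (\<forall>a\<in>L n. g a w \<in> C \<and> q {y. g a w + y \<in> C}))" for n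
  define Q where "Q n = (\<lambda>(w, C, M) (w', C', M'). R n w w' \<and> C' \<subseteq> C \<and>
    (\<forall>a\<in>L n. \<forall>y\<in>C'. g a w + y \<in> C) \<and>
    M \<subseteq> M' \<and> (\<forall>a\<in>L n. g a w \<in> M' \<and> (\<forall>u\<in>M. u + g a w \<in> M')) \<and>
    (\<forall>s. set s \<subseteq> M' \<and> length s \<le> n \<longrightarrow> C' \<subseteq> A s))" for n
  have "\<exists>\<sigma>. \<forall>n. P n (\<sigma> n) \<and> Q n (\<sigma> n) (\<sigma> (Suc n))"
  proof (rule dependent_nat_choice)
    \<comment> \<open>Since \<open>L 0\<close> is empty, nothing is demanded of the initial word;
      \<open>A []\<close> merely supplies a large set.\<close>
    show "\<exists>x. P 0 x"
      using A L(2) by (auto simp: P_def intro!: exI[of _ "(undefined, A [], {})"])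
    fix \<tau> n assume "P n \<tau>"
    moreover obtain w C M where \<tau>: "\<tau> = (w, C, M)" by (metis prod_cases3)
    ultimately have C: "q C" and M: "finite M"
      and w: "\<And>a. a \<in> L n \<Longrightarrow> g a w \<in> C" "\<And>a. a \<in> L n \<Longrightarrow> q {y. g a w + y \<in> C}"
      by (auto simp: P_def)
    define M' where "M' = M \<union> (\<lambda>a. g a w) ` L n \<union> (\<lambda>(u, a). u + g a w) ` (M \<times> L n)"
    have M': "finite M'" using M L by (simp add: M'_def)
    \<comment> \<open>The length bound makes this a finite intersection. It suffices because the
      block numbered \<open>Suc n\<close> contains only indices greater than \<open>n\<close>, and
      has \<open>n\<close> predecessors.\<close>
    define C' where "C' = C \<inter> (\<Inter>a\<in>L n. {y. g a w + y \<in> C}) \<inter>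
      (\<Inter>s\<in>{s. set s \<subseteq> M' \<and> length s \<le> n}. A s)"
    have C': "q C'"
      unfolding C'_def
      using finite_lists_length_le[OF M', of n] L(1)[of n] C w A
      by (intro ultra_Int[OF q] ultra_INT[OF q]) auto
    \<comment> \<open>Idempotence makes the second set large; values of \<open>w'\<close> in it
      leave a large set of admissible continuations at the next stage.\<close>
    obtain w' where w': "R n w w'" "\<And>a. a \<in> L (Suc n) \<Longrightarrow> g a w' \<in> C' \<inter> {x. q {y. x + y \<in> C'}}"
      using line[OF ultra_Int[OF q C' idem[OF C']], of n w] by blast
    have "P (Suc n) (w', C', M')" using C' M' w' by (auto simp: P_def)
    moreover have "Q n \<tau> (w', C', M')"
      using w'(1) by (auto simp: Q_def \<tau> C'_def M'_def)
    ultimately show "\<exists>\<tau>'. P (Suc n) \<tau>' \<and> Q n \<tau> \<tau>'" by blast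
  qed
  then obtain \<sigma> where \<sigma>: "\<And>n. P n (\<sigma> n)" "\<And>n. Q n (\<sigma> n) (\<sigma> (Suc n))" by blast
  define w where "w n = fst (\<sigma> n)" for n
  define C where "C n = fst (snd (\<sigma> n))" for n
  define M where "M n = snd (snd (\<sigma> n))" for n
  have \<sigma>_eq: "\<sigma> n = (w n, C n, M n)" for n by (simp add: w_def C_def M_def)
  have R: "R n (w n) (w (Suc n))" and Cn: "C (Suc n) \<subseteq> C n" and Mn: "M n \<subseteq> M (Suc n)"
    and CC: "\<And>a y. a \<in> L n \<Longrightarrow> y \<in> C (Suc n) \<Longrightarrow> g a (w n) + y \<in> C n"
    and wM: "\<And>a. a \<in> L n \<Longrightarrow> g a (w n) \<in> M (Suc n)"
    and MM: "\<And>a u. a \<in> L n \<Longrightarrow> u \<in> M n \<Longrightarrow> u + g a (w n) \<in> M (Suc n)"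
    and CA: "\<And>s. set s \<subseteq> M (Suc n) \<Longrightarrow> length s \<le> n \<Longrightarrow> C (Suc n) \<subseteq> A s" for n
    using \<sigma>(2)[of n] unfolding \<sigma>_eq Q_def prod.case by blast+
  have wC: "g a (w n) \<in> C n" if "a \<in> L n" for a n
    using \<sigma>(1)[of n] that unfolding \<sigma>_eq P_def by simp
  have C_dec: "C j \<subseteq> C i" if "i \<le> j" for i j
    using that Cn by (rule lift_Suc_antimono_le[rotated])
  have M_inc: "M i \<subseteq> M j" if "i \<le> j" for i j
    using that Mn by (rule lift_Suc_mono_le[rotated])
  show ?thesis
  proof (intro exI[of _ w] conjI allI impI)
    show "R n (w n) (w (Suc n))" for n by (rule R)
    fix f y F n
    assume "\<forall>n\<ge>1. f n \<in> L n"
      and "\<forall>n\<ge>1. index_set (F n) \<and> y n = ord_sum (\<lambda>i. g (f i) (w i)) (F n) \<and>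
         block_less (F n) (F (Suc n))"
    then have f: "\<And>n. 1 \<le> n \<Longrightarrow> f n \<in> L n"
      and yF: "\<And>n. 1 \<le> n \<Longrightarrow> index_set (F n) \<and> y n = ord_sum (\<lambda>i. g (f i) (w i)) (F n) \<and>
         block_less (F n) (F (Suc n))"
      by blast+
    define x where "x = (\<lambda>i. g (f i) (w i))"
    \<comment> \<open>Split off the least index \<open>b\<close>: the remaining sum lies in
      \<open>C (Suc b)\<close>, and adding the value at stage \<open>b\<close> on the left leads
      into \<open>C b\<close>.\<close>
    have in_C: "ord_sum x G \<in> C m" if "finite G" "G \<noteq> {}" "G \<subseteq> {m..}" "1 \<le> m" for G m
      using that
    proof (induction arbitrary: m rule: finite_linorder_min_induct)
      case (insert b G)
      then have b: "m \<le> b" "f b \<in> L b" using f[of b] by auto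
      show ?case
      proof (cases "G = {}")
        case True
        then show ?thesis using wC[OF b(2)] C_dec[OF b(1)] by (auto simp: x_def)
      next
        case False
        then have "ord_sum x G \<in> C (Suc b)" using insert by (intro insert.IH) (auto simp: Suc_le_eq)
        then show ?thesis
          using CC[OF b(2)] C_dec[OF b(1)] ord_sum_insert_less[OF insert(1) False, of b x] insert(2)
          by (auto simp: x_def)
      qed
    qed simp
    \<comment> \<open>Here the greatest index is split off, since \<open>M\<close> grows by adding
      new terms on the right.\<close>
    have in_M: "ord_sum x G \<in> M m" if "finite G" "G \<noteq> {}" "G \<subseteq> {1..<m}" for G m
      using that
    proof (induction arbitrary: m rule: finite_linorder_max_induct)
      case (insert b G)
      then have b: "Suc b \<le> m" "f b \<in> L b" using f[of b] by auto
      show ?case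
      proof (cases "G = {}")
        case True
        then show ?thesis using wM[OF b(2)] M_inc[OF b(1)] by (auto simp: x_def)
      next
        case False
        then have "ord_sum x G \<in> M b" using insert by (intro insert.IH) auto
        then show ?thesis
          using MM[OF b(2)] M_inc[OF b(1)] ord_sum_insert_greater[OF insert(1) False, of b x] insert(2)
          by (auto simp: x_def)
      qed
    qed simp
    have blocks: "\<And>n. 1 \<le> n \<Longrightarrow> index_set (F n) \<and> block_less (F n) (F (Suc n))"
      using yF by blast
    have Min_ge: "Suc j \<le> Min (F (Suc j))" for j
    proof (induction j)
      case 0
      have "index_set (F 1)" using yF by blast
      then show ?case by (auto simp: index_set_def Suc_le_eq)
    next
      case (Suc j)
      have "index_set (F (Suc j))" using yF by simp
      then have "Min (F (Suc j)) \<le> Max (F (Suc j))" by (simp add: index_set_def)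
      with Suc block_sequence_Max_less_Min[of F, OF blocks, of "Suc j" "Suc (Suc j)"] show ?case by simp
    qed
    \<comment> \<open>The stage just before the current block begins: all earlier sums lie in
      \<open>M (Suc N)\<close> and the current one in \<open>C (Suc N)\<close>.\<close>
    define N where "N = Min (F (Suc n)) - 1"
    have N: "Suc N = Min (F (Suc n))" "n \<le> N" using Min_ge[of n] by (auto simp: N_def)
    have "set (map (\<lambda>i. y (Suc i)) [0..<n]) \<subseteq> M (Suc N)"
    proof clarsimp
      fix i assume "i < n"
      have ix: "index_set (F (Suc i))" using yF by simp
      have "F (Suc i) \<subseteq> {1..<Suc N}"
      proof
        fix j assume j: "j \<in> F (Suc i)"
        then have "j \<le> Max (F (Suc i))" using ix by (simp add: index_set_def)
        also have "\<dots> < Suc N"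
          unfolding N(1) by (rule block_sequence_Max_less_Min[of F, OF blocks]) (use \<open>i < n\<close> in auto)
        finally show "j \<in> {1..<Suc N}" using ix j by (auto simp: index_set_def)
      qed
      then show "y (Suc i) \<in> M (Suc N)"
        using in_M[of "F (Suc i)"] ix yF[of "Suc i"] by (simp add: index_set_def x_def)
    qed
    then have "C (Suc N) \<subseteq> A (map (\<lambda>i. y (Suc i)) [0..<n])" using CA N(2) by simp
    moreover have "y (Suc n) \<in> C (Suc N)"
    proof -
      have ix: "index_set (F (Suc n))" using yF by simp
      have "F (Suc n) \<subseteq> {Suc N..}" using ix by (auto simp: N(1) index_set_def)
      then show ?thesis
        using in_C[of "F (Suc n)" "Suc N"] ix yF[of "Suc n"] by (simp add: index_set_def x_def)
    qed
    ultimately show "y (Suc n) \<in> A (map (\<lambda>i. y (Suc i)) [0..<n])" by blast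
  qed
qed

section \<open>Located words\<close>

text \<open>A located word is a list of pairs (position, letter); the letter \<open>0\<close> is the variable.\<close>

definition located :: "(nat \<Rightarrow> nat) \<Rightarrow> nat \<Rightarrow> (nat \<times> nat) list \<Rightarrow> bool" where
  "located k n w \<longleftrightarrow> w \<noteq> [] \<and> sorted_wrt (<) (map fst w) \<and> (\<forall>(j, l)\<in>set w. n < j \<and> l \<le> k j)"

definition const_word :: "(nat \<times> nat) list \<Rightarrow> bool" where
  "const_word w \<longleftrightarrow> w \<noteq> [] \<and> (\<forall>(j, l)\<in>set w. 1 \<le> l)"

definition blank_word :: "(nat \<times> nat) list \<Rightarrow> bool" where
  "blank_word w \<longleftrightarrow> w \<noteq> [] \<and> (\<forall>(j, l)\<in>set w. l = 0)"

text \<open>The shape c_1 h_1 ... c_m h_m c' mirrors the formula for \<open>x\<^sub>n\<close>: c_i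
  yields \<beta>_i, the blanks h_i occupy H_i, and c' yields \<beta>_(m+1). Non-empty pieces ensure
  that no empty sum arises.\<close>

definition var_word :: "(nat \<times> nat) list \<Rightarrow> bool" where
  "var_word w \<longleftrightarrow> (\<exists>bs c'. w = concat (map (\<lambda>(c, h). c @ h) bs) @ c' \<and> bs \<noteq> [] \<and> const_word c' \<and>
     (\<forall>(c, h)\<in>set bs. const_word c \<and> blank_word h))"

definition subst_word :: "nat \<Rightarrow> (nat \<times> nat) list \<Rightarrow> (nat \<times> nat) list" where
  "subst_word a = map (\<lambda>(j, l). (j, if l = 0 then a else l))"

definition eval_word :: "(nat \<Rightarrow> nat \<Rightarrow> 'a::semigroup_add) \<Rightarrow> (nat \<times> nat) list \<Rightarrow> 'a" where
  "eval_word y w = sg_sum_list (map (\<lambda>(j, l). y l j) w)"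

lemma subst_word_append [simp]: "subst_word a (u @ v) = subst_word a u @ subst_word a v"
  by (simp add: subst_word_def)

lemma subst_word_eq_Nil [simp]: "subst_word a w = [] \<longleftrightarrow> w = []"
  by (simp add: subst_word_def)

lemma subst_const_word: "const_word w \<Longrightarrow> subst_word a w = w"
  unfolding const_word_def subst_word_def by (intro map_idI) auto

lemma const_word_append: "const_word u \<Longrightarrow> const_word v \<Longrightarrow> const_word (u @ v)"
  by (auto simp: const_word_def)

text \<open>The constant prefix is absorbed by the first constant piece.\<close>

lemma const_append_var_word:
  assumes "const_word c" "var_word w"
  shows "var_word (c @ w)"
proof -
  obtain c1 h1 bs c' where "w = concat (map (\<lambda>(c, h). c @ h) ((c1, h1) # bs)) @ c'"
    "const_word c'" "\<forall>(c, h)\<in>set ((c1, h1) # bs). const_word c \<and> blank_word h"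
    using assms(2) unfolding var_word_def by (metis neq_Nil_conv surj_pair)
  then show ?thesis
    using const_word_append[OF assms(1)] unfolding var_word_def
    by (intro exI[of _ "(c @ c1, h1) # bs"] exI[of _ c']) auto
qed

lemma var_append_const_word:
  assumes "var_word w" "const_word c"
  shows "var_word (w @ c)"
  using assms const_word_append unfolding var_word_def by (metis append_assoc)

text \<open>The closing constant piece of \<open>w\<close> merges with the opening one of
  \<open>w'\<close>, which preserves the alternating shape.\<close>

lemma var_word_append:
  assumes "var_word w" "var_word w'"
  shows "var_word (w @ w')"
proof -
  obtain bs c where w: "w = concat (map (\<lambda>(c, h). c @ h) bs) @ c" "const_word c"
    "\<forall>(c, h)\<in>set bs. const_word c \<and> blank_word h"
    using assms(1) unfolding var_word_def by blast
  obtain bs' c' where w': "c @ w' = concat (map (\<lambda>(c, h). c @ h) bs') @ c'" "bs' \<noteq> []" "const_word c'"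
    "\<forall>(c, h)\<in>set bs'. const_word c \<and> blank_word h"
    using const_append_var_word[OF w(2) assms(2)] unfolding var_word_def by blast
  show ?thesis
    unfolding var_word_def by (rule exI[of _ "bs @ bs'"], rule exI[of _ c']) (use w w' in auto)
qed

lemma located_mono: "located k m w \<Longrightarrow> n \<le> m \<Longrightarrow> located k n w"
  by (fastforce simp: located_def)

text \<open>The bound is the last position of \<open>u\<close>: beyond it, any located word may
  follow.\<close>

lemma located_append:
  assumes u: "located k n u"
  shows "\<exists>m. \<forall>v. located k m v \<longrightarrow> located k n (u @ v)"
proof -
  let ?m = "Max (insert n (fst ` set u))"
  have m: "j \<le> ?m" if "(j, l) \<in> set u" for j l
    using that by (intro Max_ge) force+
  show ?thesis
  proof (intro exI[of _ ?m] allI impI)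
    fix v assume v: "located k ?m v"
    then have gt: "?m < j" if "(j, l) \<in> set v" for j l
      using that by (auto simp: located_def simp del: Max_insert)
    have "i < j" if "(i, a) \<in> set u" "(j, b) \<in> set v" for i a j b
      using m[OF that(1)] gt[OF that(2)] by linarith
    moreover have "located k n v" using v by (rule located_mono) simp
    ultimately show "located k n (u @ v)"
      using u by (auto simp: located_def sorted_wrt_append)
  qed
qed

lemma located_subst_word:
  assumes "located k m w" "\<And>j. m < j \<Longrightarrow> a \<le> k j"
  shows "located k m (subst_word a w)"
  using assms by (auto simp: located_def subst_word_def comp_def case_prod_beta)

lemma const_subst_word: "w \<noteq> [] \<Longrightarrow> 1 \<le> a \<Longrightarrow> const_word (subst_word a w)"
  by (auto simp: const_word_def subst_word_def)

section \<open>Values of words and the induced ultrafilter\<close>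

lemma sg_sum_list_append:
  "xs \<noteq> [] \<Longrightarrow> ys \<noteq> [] \<Longrightarrow> sg_sum_list (xs @ ys) = sg_sum_list xs + sg_sum_list ys"
proof (induction xs rule: sg_sum_list.induct)
  case (2 a)
  then show ?case by (cases ys) auto
qed (auto simp: add.assoc)

lemma eval_word_append: "u \<noteq> [] \<Longrightarrow> v \<noteq> [] \<Longrightarrow> eval_word y (u @ v) = eval_word y u + eval_word y v"
  by (simp add: eval_word_def sg_sum_list_append)

lemma eval_word_concat:
  assumes "\<And>u. u \<in> set us \<Longrightarrow> u \<noteq> []"
  shows "eval_word y (concat us) = sg_sum_list (map (eval_word y) us)"
  using assms
proof (induction us)
  case (Cons u us)
  show ?case
  proof (cases us)
    case (Cons v vs)
    then have "concat us \<noteq> []" using Cons.prems by auto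
    moreover have "sg_sum_list (map (eval_word y) (u # us)) = eval_word y u + sg_sum_list (map (eval_word y) us)"
      using Cons by simp
    ultimately show ?thesis using Cons.IH Cons.prems by (simp add: eval_word_append)
  qed simp
qed (simp add: eval_word_def)

text \<open>The ultrafilter is built on words under concatenation and then pushed forward along
  evaluation. Working with words keeps positions and letters visible, which values in the semigroup
  do not.\<close>

lemma idempotent_ultrafilter_of_lines:
  fixes k :: "nat \<Rightarrow> nat" and y :: "nat \<Rightarrow> nat \<Rightarrow> 'a::semigroup_add"
  assumes k_pos: "\<forall>n\<ge>1. 1 \<le> k n" and k_incr: "mono_on {1..} k"
  obtains q :: "'a set \<Rightarrow> bool" where "ultra q"
    "\<And>A. q A \<Longrightarrow> q {x. q {z. x + z \<in> A}}"
    "\<And>A n N. q A \<Longrightarrow> 1 \<le> N \<Longrightarrow>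
      \<exists>w. located k n w \<and> var_word w \<and> (\<forall>a\<in>{1..k N}. eval_word y (subst_word a w) \<in> A)"
proof -
  define C where "C n = {w. located k n w \<and> const_word w}" for n
  define V where "V n = {w. located k n w \<and> var_word w}" for n
  define J where "J = {a. \<exists>N\<ge>1. 1 \<le> a \<and> a \<le> k N}"
  have "[(Suc n, 1)] \<in> C n" for n
    using k_pos by (simp add: C_def located_def const_word_def)
  then have C: "C n \<noteq> {}" for n by blast
  have "[(n+1, 1), (n+2, 0), (n+3, 1)] \<in> V n" for n
  proof -
    have "var_word [(n+1, 1), (n+2, 0), (n+3, 1)]"
      unfolding var_word_def const_word_def blank_word_def
      by (rule exI[of _ "[([(n+1, 1)], [(n+2, 0)])]"], rule exI[of _ "[(n+3, 1)]"]) simp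
    then show ?thesis using k_pos by (simp add: V_def located_def)
  qed
  then have V: "V n \<noteq> {}" for n by blast
  have CV_dec: "decseq C" "decseq V"
    by (auto simp: decseq_def C_def V_def intro: located_mono)
  obtain q where q: "q \<in> at_end C" "ultra_mult (@) q q = q"
    and line: "\<And>A n J'. q A \<Longrightarrow> finite J' \<Longrightarrow> J' \<subseteq> J \<Longrightarrow> \<exists>w\<in>V n. \<forall>a\<in>J'. subst_word a w \<in> A"
  proof (rule semigroup.line_ultrafilter[OF append.semigroup_axioms C CV_dec(1) V CV_dec(2)])
    show "\<exists>m. \<forall>v\<in>C m. u @ v \<in> C n" if "u \<in> C n" for u n
      using that located_append[of k n u] const_word_append unfolding C_def V_def by blast
    show "\<exists>m. \<forall>v\<in>V m. u @ v \<in> V n" if "u \<in> C n" for u n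
      using that located_append[of k n u] const_append_var_word unfolding C_def V_def by blast
    show "\<exists>m. \<forall>v\<in>C m. u @ v \<in> V n" if "u \<in> V n" for u n
      using that located_append[of k n u] var_append_const_word unfolding C_def V_def by blast
    show "\<exists>m. \<forall>v\<in>V m. u @ v \<in> V n" if "u \<in> V n" for u n
      using that located_append[of k n u] var_word_append unfolding C_def V_def by blast
    show "subst_word a u = u" if "u \<in> C 0" for a u
      using that subst_const_word by (simp add: C_def)
    show "\<exists>m. subst_word a ` V m \<subseteq> C n" if "a \<in> J" for a n
    proof -
      from that obtain N where N: "1 \<le> N" "1 \<le> a" "a \<le> k N" by (auto simp: J_def)
      \<comment> \<open>Positions beyond \<open>n\<close> are what \<open>C n\<close> asks for;
        beyond \<open>N\<close>, monotonicity of \<open>k\<close> makes the letter \<open>a\<close>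
        admissible.\<close>
      have "subst_word a w \<in> C n" if "w \<in> V (max n N)" for w
      proof -
        have w: "located k (max n N) w" using that by (simp add: V_def)
        have "a \<le> k j" if "max n N < j" for j
          using N that mono_onD[OF k_incr, of N j] by simp
        from located_subst_word[OF w this] have "located k n (subst_word a w)"
          by (rule located_mono[OF _ max.cobounded1])
        then show ?thesis using N w const_subst_word by (simp add: C_def located_def)
      qed
      then show ?thesis by blast
    qed
  qed (use that in auto)
  define r where "r A = q (eval_word y -` A)" for A
  have u: "ultra q" and qC: "q (C 0)" using q(1) by (auto simp: at_end_def)
  have ne: "w \<noteq> []" if "w \<in> C 0" for w using that by (simp add: C_def located_def)
  show thesis
  proof (rule that[of r])
    show "ultra r" unfolding r_def using u by (rule ultra_vimage)
    fix A assume A: "r A"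
    \<comment> \<open>Evaluation is additive only on non-empty words, the empty sum being
      unspecified; so the sets are compared on the \<open>q\<close>-large set
      \<open>C 0\<close>.\<close>
    have "q {v. eval_word y u + eval_word y v \<in> A} = q {v. u @ v \<in> eval_word y -` A}"
      if "u \<in> C 0" for u
      using ne[OF that] by (intro ultra_cong[OF u qC]) (auto simp: eval_word_append dest: ne)
    then have "q {u. q {v. eval_word y u + eval_word y v \<in> A}} =
        q {u. q {v. u @ v \<in> eval_word y -` A}}"
      by (intro ultra_cong[OF u qC]) auto
    then show "r {x. r {z. x + z \<in> A}}"
      using A fun_cong[OF q(2), of "eval_word y -` A"]
      by (simp add: r_def ultra_mult_def vimage_def)
  next
    fix A n N assume A: "r A" and "(1::nat) \<le> N"
    then have "{1..k N} \<subseteq> J" by (auto simp: J_def)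
    then show "\<exists>w. located k n w \<and> var_word w \<and> (\<forall>a\<in>{1..k N}. eval_word y (subst_word a w) \<in> A)"
      using line[OF A[unfolded r_def] finite_atLeastAtMost, of 1 "k N" n] by (auto simp: V_def)
  qed
qed

text \<open>All requirements on a single block \<open>E\<^sub>n\<close>, with the positions of
  \<open>w\<close> as \<open>E\<^sub>n\<close>, together with the identity between the formula for
  \<open>x\<^sub>n\<close> and the value of \<open>w\<close> at each letter.\<close>

definition decomposition ::
  "(nat \<Rightarrow> nat \<Rightarrow> 'a::semigroup_add) \<Rightarrow> (nat \<Rightarrow> nat) \<Rightarrow> (nat \<times> nat) list \<Rightarrow>
   nat \<Rightarrow> (nat \<Rightarrow> nat set) \<Rightarrow> (nat \<Rightarrow> nat set) \<Rightarrow> (nat \<Rightarrow> nat) \<Rightarrow> (nat \<Rightarrow> 'a) \<Rightarrow> bool" where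
  "decomposition y k w m Es H l \<beta> \<longleftrightarrow>
        1 \<le> m \<and>
        (\<forall>i\<in>{1..m + 1}. index_set (Es i)) \<and>
        (\<forall>i\<in>{1..m}. block_less (Es i) (Es (Suc i))) \<and>
        fst ` set w = (\<Union>i\<in>{1..m + 1}. Es i) \<and>
        (\<forall>i\<in>{1..m}. H i \<subseteq> Es i \<and> H i \<noteq> {} \<and> Es i - H i \<noteq> {}) \<and>
        (\<forall>i\<in>{1..m}. (\<forall>j\<in>Es i - H i. 1 \<le> l j \<and> l j \<le> k j) \<and>
           \<beta> i = ord_sum (\<lambda>j. y (l j) j) (Es i - H i)) \<and>
        (\<forall>j\<in>Es (m + 1). 1 \<le> l j \<and> l j \<le> k j) \<and>
        \<beta> (m + 1) = ord_sum (\<lambda>j. y (l j) j) (Es (m + 1)) \<and>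
        (\<forall>a. ord_sum (\<lambda>i. \<beta> i + ord_sum (\<lambda>t. y a t) (H i)) {1..m} + \<beta> (m + 1) =
             eval_word y (subst_word a w))"

lemma sorted_wrt_concatD:
  "sorted_wrt P (concat xss) \<Longrightarrow> i < j \<Longrightarrow> j < length xss \<Longrightarrow> x \<in> set (xss ! i) \<Longrightarrow>
    z \<in> set (xss ! j) \<Longrightarrow> P x z"
proof (induction xss arbitrary: i j)
  case (Cons xs xss)
  show ?case
  proof (cases i)
    case 0
    then obtain j' where j': "j = Suc j'" using Cons.prems by (cases j) auto
    have "\<forall>x\<in>set xs. \<forall>u\<in>set xss. \<forall>z\<in>set u. P x z"
      using Cons.prems(1) by (auto simp: sorted_wrt_append)
    moreover have "x \<in> set xs" "xss ! j' \<in> set xss" "z \<in> set (xss ! j')"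
      using Cons.prems 0 j' by auto
    ultimately show ?thesis by blast
  next
    case (Suc i')
    then obtain j' where "j = Suc j'" using Cons.prems by (cases j) auto
    then show ?thesis using Cons Suc by (auto simp: sorted_wrt_append)
  qed
qed simp

lemma sorted_wrt_concat_nth:
  "sorted_wrt P (concat xss) \<Longrightarrow> i < length xss \<Longrightarrow> sorted_wrt P (xss ! i)"
  by (induction xss arbitrary: i) (auto simp: sorted_wrt_append nth_Cons split: nat.split)

text \<open>Strictly increasing positions make the list of positions the sorted list of its set, so
  the set-indexed sum and the word have the same terms in the same order.\<close>

lemma ord_sum_fst:
  assumes "sorted_wrt (<) (map fst c)" "\<And>j l. (j, l) \<in> set c \<Longrightarrow> z j = y l j"
  shows "ord_sum z (fst ` set c) = eval_word y c"
proof -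
  have "sorted_list_of_set (fst ` set c) = map fst c"
    using assms(1) sorted_list_of_set.idem_if_sorted_distinct[of "map fst c"]
    by (simp add: strict_sorted_iff)
  moreover have "map (z \<circ> fst) c = map (\<lambda>(j, l). y l j) c"
    using assms(2) by (intro map_cong) auto
  ultimately show ?thesis unfolding ord_sum_def eval_word_def by (simp only: map_map)
qed

text \<open>Read the data off the shape of the word: \<open>Es i\<close> holds the positions of the
  i-th constant piece and the blanks after it, \<open>H i\<close> those of the blanks. Substitution
  alters the blanks only.\<close>

lemma var_word_decomposition:
  assumes "located k n w" "var_word w"
  shows "\<exists>m Es H l \<beta>. decomposition y k w m Es H l \<beta>"
proof -
  obtain bs c' where w: "w = concat (map (\<lambda>(c, h). c @ h) bs) @ c'" "bs \<noteq> []" "const_word c'"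
    "\<forall>(c, h)\<in>set bs. const_word c \<and> blank_word h"
    using assms(2) unfolding var_word_def by blast
  define m where "m = length bs"
  \<comment> \<open>The list of all blocks, the closing constant included. Lists count from 0 and
    blocks from 1, hence the shift \<open>i - 1\<close> below.\<close>
  define B where "B = map (\<lambda>(c, h). c @ h) bs @ [c']"
  have wB: "w = concat B" and lB: "length B = Suc m" by (simp_all add: w(1) B_def m_def)
  define c where "c i = fst (bs ! (i - 1))" for i
  define h where "h i = snd (bs ! (i - 1))" for i
  have ch: "const_word (c i)" "blank_word (h i)" "B ! (i - 1) = c i @ h i" if "i \<in> {1..m}" for i
    using that bspec[OF w(4), of "bs ! (i - 1)"]
    by (auto simp: c_def h_def B_def m_def nth_append case_prod_beta)
  have Bm: "B ! m = c'" by (simp add: B_def m_def nth_append)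
  define Es where "Es i = fst ` set (B ! (i - 1))" for i
  define H where "H i = fst ` set (h i)" for i
  define l where "l j = the (map_of w j)" for j
  define \<beta> where "\<beta> i = eval_word y (if i \<le> m then c i else c')" for i
  have sw: "sorted_wrt (<) (map fst w)" and wk: "\<And>j l. (j, l) \<in> set w \<Longrightarrow> n < j \<and> l \<le> k j"
    using assms(1) by (auto simp: located_def)
  have sB: "sorted_wrt (\<lambda>x z. fst x < fst z) (concat B)" using sw by (simp add: wB sorted_wrt_map)
  have sBi: "sorted_wrt (<) (map fst (B ! i))" if "i < Suc m" for i
    using sorted_wrt_concat_nth[OF sB, of i] that by (simp add: lB sorted_wrt_map)
  have lw: "l j = b" if "(j, b) \<in> set w" for j b
    using that sw by (simp add: l_def strict_sorted_iff map_of_is_SomeI)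
  have Bw: "set (B ! i) \<subseteq> set w" if "i < Suc m" for i
    using nth_mem[of i B] that unfolding lB wB set_concat by blast
  have Bne: "B ! (i - 1) \<noteq> []" if "i \<in> {1..m + 1}" for i
    using that ch[of i] Bm w(3) by (cases "i = m + 1") (auto simp: const_word_def)
  have cw: "set (c i) \<subseteq> set w" and sc: "sorted_wrt (<) (map fst (c i))" "sorted_wrt (<) (map fst (h i))"
    and dif: "Es i - H i = fst ` set (c i)" if "i \<in> {1..m}" for i
  proof -
    have i: "i - 1 < Suc m" using that by auto
    show "set (c i) \<subseteq> set w" using Bw[OF i] ch(3)[OF that] by auto
    show "sorted_wrt (<) (map fst (c i))" "sorted_wrt (<) (map fst (h i))"
      using sBi[OF i] ch(3)[OF that] by (auto simp: sorted_wrt_append)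
    have "fst ` set (c i) \<inter> fst ` set (h i) = {}"
      using sBi[OF i] ch(3)[OF that] by (force simp: sorted_wrt_append)
    then show "Es i - H i = fst ` set (c i)" unfolding Es_def H_def ch(3)[OF that] by auto
  qed
  have c'w: "set c' \<subseteq> set w" and sc': "sorted_wrt (<) (map fst c')"
    using Bw[of m] sBi[of m] Bm by auto
  have ok: "1 \<le> l j \<and> l j \<le> k j" if "set u \<subseteq> set w" "const_word u" "j \<in> fst ` set u" for u j
    using that lw wk by (fastforce simp: const_word_def)
  have sum: "eval_word y u = ord_sum (\<lambda>j. y (l j) j) (fst ` set u)"
    if "set u \<subseteq> set w" "sorted_wrt (<) (map fst u)" for u
    using that lw by (intro ord_sum_fst[symmetric]) auto
  have "decomposition y k w m Es H l \<beta>"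
    unfolding decomposition_def
  proof (intro conjI ballI allI)
    show "1 \<le> m" using w(2) by (cases bs) (auto simp: m_def)
    show "index_set (Es i)" if "i \<in> {1..m + 1}" for i
    proof -
      have "set (B ! (i - 1)) \<subseteq> set w" using that by (intro Bw) auto
      then show ?thesis using Bne[OF that] wk by (fastforce simp: index_set_def Es_def)
    qed
    show "block_less (Es i) (Es (Suc i))" if "i \<in> {1..m}" for i
    proof -
      have "fst x < fst z" if "x \<in> set (B ! (i - 1))" "z \<in> set (B ! i)" for x z
        using sorted_wrt_concatD[OF sB _ _ that] \<open>i \<in> {1..m}\<close> lB by auto
      moreover have "Max (Es i) \<in> Es i" "Min (Es (Suc i)) \<in> Es (Suc i)"
        using Bne[of i] Bne[of "Suc i"] that unfolding Es_def by (intro Max_in Min_in; simp)+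
      ultimately show ?thesis unfolding block_less_def Es_def by fastforce
    qed
    show "fst ` set w = (\<Union>i\<in>{1..m + 1}. Es i)"
    proof -
      have "set w = (\<Union>i\<in>{..<Suc m}. set (B ! i))"
      proof -
        have "set B = (!) B ` {..<Suc m}" by (auto simp: set_conv_nth lB)
        then show ?thesis unfolding wB set_concat by simp
      qed
      also have "{..<Suc m} = (\<lambda>i. i - 1) ` {1..m + 1}"
        by (auto simp: image_iff intro!: bexI[of _ "Suc _"])
      finally show ?thesis by (simp add: Es_def image_UN)
    qed
    fix i assume i: "i \<in> {1..m}"
    show "H i \<subseteq> Es i" unfolding Es_def H_def ch(3)[OF i] by auto
    show "H i \<noteq> {}" using ch(2)[OF i] by (auto simp: H_def blank_word_def)
    show "Es i - H i \<noteq> {}" using ch(1)[OF i] by (auto simp: dif[OF i] const_word_def)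
    show "1 \<le> l j" "l j \<le> k j" if "j \<in> Es i - H i" for j
      using ok[OF cw[OF i] ch(1)[OF i]] that by (auto simp: dif[OF i])
    show "\<beta> i = ord_sum (\<lambda>j. y (l j) j) (Es i - H i)"
      using i sum[OF cw[OF i] sc(1)[OF i]] by (simp add: dif[OF i] \<beta>_def)
  next
    show "1 \<le> l j" "l j \<le> k j" if "j \<in> Es (m + 1)" for j
      using ok[OF c'w w(3)] that by (auto simp: Es_def Bm)
    show "\<beta> (m + 1) = ord_sum (\<lambda>j. y (l j) j) (Es (m + 1))"
      using sum[OF c'w sc'] by (simp add: Es_def Bm \<beta>_def)
    fix a
    have term_eq: "\<beta> (Suc i) + ord_sum (\<lambda>t. y a t) (H (Suc i)) =
        eval_word y (case bs ! i of (c, h) \<Rightarrow> c @ subst_word a h)" if "i < m" for i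
    proof -
      have i: "Suc i \<in> {1..m}" using that by auto
      have "ord_sum (\<lambda>t. y a t) (fst ` set (subst_word a (h (Suc i)))) =
          eval_word y (subst_word a (h (Suc i)))"
        using sc(2)[OF i] ch(2)[OF i]
        by (intro ord_sum_fst) (auto simp: subst_word_def comp_def case_prod_beta blank_word_def)
      moreover have "fst ` set (subst_word a (h (Suc i))) = H (Suc i)"
        by (force simp: subst_word_def H_def)
      moreover have "bs ! i = (c (Suc i), h (Suc i))" by (simp add: c_def h_def)
      ultimately show ?thesis
        using ch[OF i] i by (simp add: \<beta>_def eval_word_append const_word_def blank_word_def)
    qed
    have "ord_sum (\<lambda>i. \<beta> i + ord_sum (\<lambda>t. y a t) (H i)) {1..m} =
        sg_sum_list (map (\<lambda>i. \<beta> (Suc i) + ord_sum (\<lambda>t. y a t) (H (Suc i))) [0..<m])"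
    proof -
      have "sorted_list_of_set {1..m} = map Suc [0..<m]"
        by (metis One_nat_def atLeastLessThanSuc_atLeastAtMost map_Suc_upt sorted_list_of_set_range)
      then show ?thesis by (simp add: ord_sum_def comp_def)
    qed
    also have "map (\<lambda>i. \<beta> (Suc i) + ord_sum (\<lambda>t. y a t) (H (Suc i))) [0..<m] =
        map (\<lambda>b. eval_word y (case b of (c, h) \<Rightarrow> c @ subst_word a h)) bs"
      using term_eq by (intro nth_equalityI) (auto simp: m_def)
    also have "sg_sum_list \<dots> = eval_word y (concat (map (\<lambda>(c, h). c @ subst_word a h) bs))"
      using w(4) by (subst eval_word_concat) (auto simp: const_word_def comp_def)
    finally have S: "ord_sum (\<lambda>i. \<beta> i + ord_sum (\<lambda>t. y a t) (H i)) {1..m} =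
        eval_word y (concat (map (\<lambda>(c, h). c @ subst_word a h) bs))" .
    have "subst_word a (concat (map (\<lambda>(c, h). c @ h) bs)) = concat (map (\<lambda>(c, h). c @ subst_word a h) bs)"
    proof -
      have "map (subst_word a) (map (\<lambda>(c, h). c @ h) bs) = map (\<lambda>(c, h). c @ subst_word a h) bs"
        using w(4) subst_const_word by auto
      moreover have "subst_word a (concat us) = concat (map (subst_word a) us)" for us
        by (simp add: subst_word_def map_concat)
      ultimately show ?thesis by (simp only:)
    qed
    moreover have "concat (map (\<lambda>(c, h). c @ subst_word a h) bs) \<noteq> []"
      using w(2,4) by (cases bs) (auto simp: const_word_def)
    moreover have "c' \<noteq> []" using w(3) by (simp add: const_word_def)
    moreover have "\<beta> (m + 1) = eval_word y c'" by (simp add: \<beta>_def)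
    ultimately show "ord_sum (\<lambda>i. \<beta> i + ord_sum (\<lambda>t. y a t) (H i)) {1..m} + \<beta> (m + 1) =
        eval_word y (subst_word a w)"
      unfolding S by (simp only: w(1) subst_word_append subst_const_word[OF w(3)] eval_word_append
          simp_thms)
  qed
  then show ?thesis by blast
qed

section \<open>The dichotomy for pointwise closed families\<close>

text \<open>A basic open box around \<open>p\<close> inside the complement restricts finitely many
  coordinates; \<open>n\<close> bounds them.\<close>

lemma pointwise_closed_complement:
  assumes "pointwise_closed U" "p \<in> {1..} \<rightarrow>\<^sub>E UNIV" "p \<notin> U"
  obtains n where "\<And>p'. p' \<in> {1..} \<rightarrow>\<^sub>E UNIV \<Longrightarrow> (\<And>i. 1 \<le> i \<Longrightarrow> i \<le> n \<Longrightarrow> p' i = p i) \<Longrightarrow> p' \<notin> U"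
proof -
  let ?X = "product_topology (\<lambda>_. discrete_topology UNIV) {1..}"
  have "openin ?X (topspace ?X - U)"
    using assms(1) unfolding pointwise_closed_def by blast
  moreover have "p \<in> topspace ?X - U" using assms by simp
  ultimately obtain X where X: "finite {i \<in> {1..}. X i \<noteq> UNIV}" "p \<in> Pi\<^sub>E {1..} X"
    "Pi\<^sub>E {1..} X \<subseteq> topspace ?X - U"
    unfolding openin_product_topology_alt topspace_discrete_topology by meson
  obtain n where n: "\<forall>i\<in>{i \<in> {1..}. X i \<noteq> UNIV}. i \<le> n"
    using X(1) finite_nat_set_iff_bounded_le by blast
  show thesis
  proof (rule that[of n])
    fix p' :: "nat \<Rightarrow> 'a" assume p': "p' \<in> {1..} \<rightarrow>\<^sub>E UNIV" "\<And>i. 1 \<le> i \<Longrightarrow> i \<le> n \<Longrightarrow> p' i = p i"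
    have "p' i \<in> X i" if "i \<in> {1..}" for i
    proof (cases "i \<le> n")
      case True
      then show ?thesis using p'(2)[of i] that X(2) by (auto simp: PiE_iff)
    next
      case False
      then have "X i = UNIV" using n that by blast
      then show ?thesis by simp
    qed
    then have "p' \<in> Pi\<^sub>E {1..} X" using p'(1) by (auto simp: PiE_iff)
    then show "p' \<notin> U" using X(3) by blast
  qed
qed

theorem theorem3p19:
  fixes k :: "nat \<Rightarrow> nat"
    and y :: "nat \<Rightarrow> nat \<Rightarrow> 'a::semigroup_add"
    and U :: "(nat \<Rightarrow> 'a) set"
  assumes k_pos: "\<forall>n\<ge>1. 1 \<le> k n"
    and k_incr: "mono_on {1..} k"
    and U_subset: "U \<subseteq> {1..} \<rightarrow>\<^sub>E UNIV"
    and U_closed: "pointwise_closed U"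
  shows "\<exists>(E :: nat \<Rightarrow> nat set) (m :: nat \<Rightarrow> nat) (Es :: nat \<Rightarrow> nat \<Rightarrow> nat set)
      (H :: nat \<Rightarrow> nat \<Rightarrow> nat set) (l :: nat \<Rightarrow> nat \<Rightarrow> nat) (\<beta> :: nat \<Rightarrow> nat \<Rightarrow> 'a).
    (\<forall>n\<ge>1.
        index_set (E n) \<and> block_less (E n) (E (Suc n)) \<and>
        1 \<le> m n \<and>
        (\<forall>i\<in>{1..m n + 1}. index_set (Es n i)) \<and>
        (\<forall>i\<in>{1..m n}. block_less (Es n i) (Es n (Suc i))) \<and>
        E n = (\<Union>i\<in>{1..m n + 1}. Es n i) \<and>
        (\<forall>i\<in>{1..m n}. H n i \<subseteq> Es n i \<and> H n i \<noteq> {} \<and> Es n i - H n i \<noteq> {}) \<and>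
        (\<forall>i\<in>{1..m n}. (\<forall>j\<in>Es n i - H n i. 1 \<le> l n j \<and> l n j \<le> k j) \<and>
           \<beta> n i = ord_sum (\<lambda>j. y (l n j) j) (Es n i - H n i)) \<and>
        (\<forall>j\<in>Es n (m n + 1). 1 \<le> l n j \<and> l n j \<le> k j) \<and>
        \<beta> n (m n + 1) = ord_sum (\<lambda>j. y (l n j) j) (Es n (m n + 1))) \<and>
    (\<forall>f :: nat \<Rightarrow> nat. (\<forall>n\<ge>1. 1 \<le> f n \<and> f n \<le> k n) \<longrightarrow>
       (let x = (\<lambda>n. ord_sum (\<lambda>i. \<beta> n i + ord_sum (\<lambda>t. y (f n) t) (H n i)) {1..m n}
                     + \<beta> n (m n + 1))
        in FS_omega x \<subseteq> U \<or> FS_omega x \<subseteq> ({1..} \<rightarrow>\<^sub>E UNIV) - U))"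
proof -
  obtain q :: "'a set \<Rightarrow> bool" where q: "ultra q"
    "\<And>A. q A \<Longrightarrow> q {x. q {z. x + z \<in> A}}"
    "\<And>A n N. q A \<Longrightarrow> 1 \<le> N \<Longrightarrow>
      \<exists>w. located k n w \<and> var_word w \<and> (\<forall>a\<in>{1..k N}. eval_word y (subst_word a w) \<in> A)"
    by (rule idempotent_ultrafilter_of_lines[OF k_pos k_incr, where y = y]) (rule that, blast+)
  \<comment> \<open>Translates sequences indexed from 0, as used for trees, into extensional
    sequences indexed from 1.\<close>
  define ext :: "(nat \<Rightarrow> 'a) \<Rightarrow> nat \<Rightarrow> 'a" where "ext z = (\<lambda>n\<in>{1..}. z (n - 1))" for z
  have ext: "ext z \<in> {1..} \<rightarrow>\<^sub>E UNIV" for z by (simp add: ext_def)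
  define W where "W = {z. ext z \<notin> U}"
  have W_open: "\<exists>n. \<forall>z'. (\<forall>i<n. z' i = z i) \<longrightarrow> z' \<in> W" if "z \<in> W" for z
  proof -
    have "ext z \<notin> U" using that by (simp add: W_def)
    from pointwise_closed_complement[OF U_closed ext this] obtain n
      where n: "\<And>p'. p' \<in> {1..} \<rightarrow>\<^sub>E UNIV \<Longrightarrow> (\<And>i. 1 \<le> i \<Longrightarrow> i \<le> n \<Longrightarrow> p' i = ext z i) \<Longrightarrow> p' \<notin> U"
      by blast
    have "z' \<in> W" if "\<forall>i<n. z' i = z i" for z'
      unfolding W_def mem_Collect_eq by (rule n[OF ext]) (use that in \<open>simp add: ext_def\<close>)
    then show ?thesis by blast
  qed
  obtain A :: "'a list \<Rightarrow> 'a set" where A: "\<And>s. q (A s)"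
    "(\<forall>z. (\<forall>n. z n \<in> A (map z [0..<n])) \<longrightarrow> z \<in> W) \<or>
     (\<forall>z. (\<forall>n. z n \<in> A (map z [0..<n])) \<longrightarrow> z \<notin> W)"
    using ultra_tree_dichotomy[OF q(1) W_open] by blast
  define L where "L n = (if n = 0 then {} else {1..k n})" for n
  \<comment> \<open>Each word must start after the previous one ends. Inserting 0 keeps the maximum
    meaningful if the unconstrained word at stage 0 is empty.\<close>
  define R where "R (n::nat) w w' \<longleftrightarrow> var_word w' \<and> located k (Max (insert 0 (fst ` set w))) w'"
    for n and w w' :: "(nat \<times> nat) list"
  have "\<exists>w'. R n w w' \<and> (\<forall>a\<in>L (Suc n). eval_word y (subst_word a w') \<in> B)" if "q B" for B n w
    using q(3)[OF that, of "Suc n"] by (auto simp: R_def L_def simp del: Max_insert)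
  then have "\<exists>w. (\<forall>n. R n (w n) (w (Suc n))) \<and>
    (\<forall>f z F. (\<forall>n\<ge>1. f n \<in> L n) \<longrightarrow>
      (\<forall>n\<ge>1. index_set (F n) \<and>
         z n = ord_sum (\<lambda>i. eval_word y (subst_word (f i) (w i))) (F n) \<and>
         block_less (F n) (F (Suc n))) \<longrightarrow>
      (\<forall>n. z (Suc n) \<in> A (map (\<lambda>i. z (Suc i)) [0..<n])))"
    by (intro fusion[where g = "\<lambda>a w. eval_word y (subst_word a w)", OF q(1)] q(2) A(1))
      (auto simp: L_def)
  then
  obtain w where w: "\<And>n. R n (w n) (w (Suc n))"
    and branch: "\<And>f z F n. \<lbrakk>\<forall>n\<ge>1. f n \<in> L n; \<forall>n\<ge>1. index_set (F n) \<and>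
         z n = ord_sum (\<lambda>i. eval_word y (subst_word (f i) (w i))) (F n) \<and>
         block_less (F n) (F (Suc n))\<rbrakk> \<Longrightarrow>
      z (Suc n) \<in> A (map (\<lambda>i. z (Suc i)) [0..<n])"
    by blast
  have loc: "var_word (w n)" "located k (Max (insert 0 (fst ` set (w (n - 1))))) (w n)" if "1 \<le> n" for n
    using w[of "n - 1"] that by (auto simp: R_def simp del: Max_insert)
  have "\<forall>n. \<exists>m Es H l \<beta>. 1 \<le> n \<longrightarrow> decomposition y k (w n) m Es H l \<beta>"
    using var_word_decomposition[OF loc(2,1)] by blast
  then obtain m Es H l \<beta> where dec: "\<And>n. 1 \<le> n \<Longrightarrow> decomposition y k (w n) (m n) (Es n) (H n) (l n) (\<beta> n)"
    by metis
  let ?E = "\<lambda>n. fst ` set (w n)"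
  let ?x = "\<lambda>f n. ord_sum (\<lambda>i. \<beta> n i + ord_sum (\<lambda>t. y (f n) t) (H n i)) {1..m n} + \<beta> n (m n + 1)"
  have E: "index_set (?E n)" "block_less (?E n) (?E (Suc n))" if "1 \<le> n" for n
  proof -
    have ne: "w n \<noteq> []" "w (Suc n) \<noteq> []" using loc(2)[of n] loc(2)[of "Suc n"] that by (auto simp: located_def)
    show "index_set (?E n)" using loc(2)[OF that] ne by (fastforce simp: index_set_def located_def)
    have "Max (insert 0 (?E n)) < j" if "j \<in> ?E (Suc n)" for j
      using loc(2)[of "Suc n"] that by (auto simp: located_def simp del: Max_insert Max_less_iff)
    then show "block_less (?E n) (?E (Suc n))"
      using ne by (auto simp: block_less_def)
  qed
  have dich: "FS_omega (?x f) \<subseteq> U \<or> FS_omega (?x f) \<subseteq> ({1..} \<rightarrow>\<^sub>E UNIV) - U"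
    if f: "\<forall>n\<ge>1. 1 \<le> f n \<and> f n \<le> k n" for f
  proof -
    have x: "?x f n = eval_word y (subst_word (f n) (w n))" if "1 \<le> n" for n
      using dec[OF that] unfolding decomposition_def by blast
    \<comment> \<open>After the index shift, every sequence in \<open>FS_omega\<close> is a branch
      of the tree.\<close>
    have *: "(\<lambda>i. z (Suc i)) i \<in> A (map (\<lambda>i. z (Suc i)) [0..<i])" "ext (\<lambda>i. z (Suc i)) = z"
      "z \<in> {1..} \<rightarrow>\<^sub>E UNIV" if z: "z \<in> FS_omega (?x f)" for z i
    proof -
      show "z \<in> {1..} \<rightarrow>\<^sub>E UNIV" using z unfolding FS_omega_def PiE_iff by blast
      then show "ext (\<lambda>i. z (Suc i)) = z" by (auto simp: ext_def PiE_iff extensional_def fun_eq_iff)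
      obtain F where F: "\<forall>n\<ge>1. index_set (F n) \<and> z n = ord_sum (?x f) (F n) \<and> block_less (F n) (F (Suc n))"
        using z unfolding FS_omega_def by blast
      have "ord_sum (?x f) (F n) = ord_sum (\<lambda>i. eval_word y (subst_word (f i) (w i))) (F n)"
        if "1 \<le> n" for n
      proof -
        have "index_set (F n)" using F that by blast
        then have "1 \<le> i" if "i \<in> set (sorted_list_of_set (F n))" for i
          using that by (auto simp: index_set_def)
        then show ?thesis unfolding ord_sum_def[where F = "F n"]
          using x by (intro arg_cong[of _ _ sg_sum_list] map_cong refl) blast
      qed
      then show "(\<lambda>i. z (Suc i)) i \<in> A (map (\<lambda>i. z (Suc i)) [0..<i])"
        using F f by (intro branch[of f F]) (auto simp: L_def)
    qed
    \<comment> \<open>The tree was fixed before \<open>f\<close>, so the same alternative holds for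
      every \<open>f\<close>.\<close>
    show ?thesis
      using A(2)
    proof
      assume "\<forall>z. (\<forall>n. z n \<in> A (map z [0..<n])) \<longrightarrow> z \<in> W"
      then have "z \<in> ({1..} \<rightarrow>\<^sub>E UNIV) - U" if "z \<in> FS_omega (?x f)" for z
        using *[OF that] unfolding W_def by (metis DiffI mem_Collect_eq)
      then show ?thesis by blast
    next
      assume "\<forall>z. (\<forall>n. z n \<in> A (map z [0..<n])) \<longrightarrow> z \<notin> W"
      then have "z \<in> U" if "z \<in> FS_omega (?x f)" for z
        using *[OF that] unfolding W_def by (metis mem_Collect_eq)
      then show ?thesis by blast
    qed
  qed
  show ?thesis
    unfolding Let_def
  proof (rule exI[of _ ?E], rule exI[of _ m], rule exI[of _ Es], rule exI[of _ H],
      rule exI[of _ l], rule exI[of _ \<beta>], rule conjI; intro allI impI)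
    fix n :: nat assume "1 \<le> n"
    note E[OF this] dec[OF this, unfolded decomposition_def]
    then show "index_set (?E n) \<and> block_less (?E n) (?E (Suc n)) \<and>
        1 \<le> m n \<and>
        (\<forall>i\<in>{1..m n + 1}. index_set (Es n i)) \<and>
        (\<forall>i\<in>{1..m n}. block_less (Es n i) (Es n (Suc i))) \<and>
        ?E n = (\<Union>i\<in>{1..m n + 1}. Es n i) \<and>
        (\<forall>i\<in>{1..m n}. H n i \<subseteq> Es n i \<and> H n i \<noteq> {} \<and> Es n i - H n i \<noteq> {}) \<and>
        (\<forall>i\<in>{1..m n}. (\<forall>j\<in>Es n i - H n i. 1 \<le> l n j \<and> l n j \<le> k j) \<and>
           \<beta> n i = ord_sum (\<lambda>j. y (l n j) j) (Es n i - H n i)) \<and>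
        (\<forall>j\<in>Es n (m n + 1). 1 \<le> l n j \<and> l n j \<le> k j) \<and>
        \<beta> n (m n + 1) = ord_sum (\<lambda>j. y (l n j) j) (Es n (m n + 1))"
      by (elim conjE, intro conjI) assumption+
  qed (rule dich)
qed

end
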